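(* Let $f$ be a Perron function with good continuity. Then $\sigma'_{f,\liminf}$ is the closure (in $[-\infty,\infty]$) of $\tau'_{f,\liminf}$, and $\sigma'_{f,\limsup}$ is the closure of $\tau'_{f,\limsup}$: $$\sigma'_{f,\liminf}=\mathrm{cl}(\tau'_{f,\liminf}),\qquad \sigma'_{f,\limsup}=\mathrm{cl}(\tau'_{f,\limsup}).$$
   Context: $\mathbb{N}^+=\{1,2,\dots\}$. Fix an integer $l\ge 0$. A Perron function is a function $f:[0,1]^2\times(\mathbb{N}^+\cup\{\infty\})^l\to[-\infty,\infty]$, $(\alpha,\beta,n_0,\dots,n_{l-1})\mapsto f(\alpha,\beta,n_0,\dots,n_{l-1})$. It has good continuity if: (i) there is $I\in[-\infty,\infty]$ such that for every neighbourhood $B$ of $I$ in $[-\infty,\infty]$ there is $C$ with $f(\alpha,\beta,n_0,\dots,n_{l-1})\in B$ for all $\alpha,\beta\in[0,1]$ and all $n_0,\dots,n_{l-1}$ with $\max(n_0,\dots,n_{l-1})>C$; moreover $f=I$ whenever some $n_i=\infty$ (this condition is vacuous if $l=0$); (ii) for all finite $n_0,\dots,n_{l-1}$ the map $(\alpha,\beta)\mapsto f(\alpha,\beta,n_0,\dots,n_{l-1})$ is continuous on $[0,1]^2$. For a sequence $a:\mathbb{Z}\to\mathbb{N}^+$ put $\alpha^{[a]}_n=[0;a_{n+1},a_{n+2},\dots]$, $\beta^{[a]}_n=[0;a_{n-1},a_{n-2},\dots]$ (continued fractions, $[0;s_1,s_2,\dots]=1/(s_1+1/(s_2+\cdots))$)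 and $P^{[a]}_k=f(\alpha^{[a]}_{k+l-1},\beta^{[a]}_k,a_k,\dots,a_{k+l-1})$ for $k\in\mathbb{Z}$. All $\liminf_k,\limsup_k$ are over $k\in\mathbb{Z}$ as $|k|\to\infty$. $\sigma'_{f,\liminf}=\{\liminf_k P^{[a]}_k : a:\mathbb{Z}\to\mathbb{N}^+\}$, $\sigma'_{f,\limsup}=\{\limsup_k P^{[a]}_k : a:\mathbb{Z}\to\mathbb{N}^+\}$; $\tau'_{f,\liminf}$ and $\tau'_{f,\limsup}$ are defined in the same way but with $a:\mathbb{Z}\to\mathbb{N}^+$ ranging only over periodic sequences. *)

theory Defs
  imports "HOL-Analysis.Analysis"
begin

primrec cfrac_conv :: "nat \<Rightarrow> (nat \<Rightarrow> nat) \<Rightarrow> real" where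
  "cfrac_conv 0 s = 0"
| "cfrac_conv (Suc n) s = 1 / (real (s 0) + cfrac_conv n (\<lambda>i. s (Suc i)))"

text \<open>The sequence of partial quotients is indexed from 0: \<open>cfrac s\<close> is
  \<open>[0; s 0, s 1, s 2, \<dots>]\<close>. The limit exists whenever all \<open>s i\<close> are positive.\<close>

definition cfrac :: "(nat \<Rightarrow> nat) \<Rightarrow> real" where
  "cfrac s = lim (\<lambda>n. cfrac_conv n s)"

definition alpha_cf :: "(int \<Rightarrow> nat) \<Rightarrow> int \<Rightarrow> real" where
  "alpha_cf a n = cfrac (\<lambda>i. a (n + 1 + int i))"

definition beta_cf :: "(int \<Rightarrow> nat) \<Rightarrow> int \<Rightarrow> real" where
  "beta_cf a n = cfrac (\<lambda>i. a (n - 1 - int i))"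

text \<open>A Perron function with parameter \<open>l\<close> is given by a function on all reals and all lists, of
  which only the values on \<open>[0,1]\<^sup>2\<close> and on lists in \<open>perron_args l\<close> matter.\<close>

type_synonym perron_fun = "real \<Rightarrow> real \<Rightarrow> enat list \<Rightarrow> ereal"

definition perron_args :: "nat \<Rightarrow> enat list set" where
  "perron_args l = {ns. length ns = l \<and> (\<forall>n\<in>set ns. 1 \<le> n)}"

text \<open>In the first condition, the maximum of the entries of \<open>ns\<close> exceeds \<open>C\<close> iff some entry does;
  phrased this way the condition is vacuous for \<open>l = 0\<close>.\<close>

definition good_continuity :: "nat \<Rightarrow> perron_fun \<Rightarrow> bool" where
  "good_continuity l f \<longleftrightarrow>
     (\<exists>I::ereal.
        (\<forall>B. open B \<and> I \<in> B \<longrightarrow>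
           (\<exists>C::nat. \<forall>\<alpha>\<in>{0..1}. \<forall>\<beta>\<in>{0..1}. \<forall>ns\<in>perron_args l.
              (\<exists>n\<in>set ns. enat C < n) \<longrightarrow> f \<alpha> \<beta> ns \<in> B)) \<and>
        (\<forall>\<alpha>\<in>{0..1}. \<forall>\<beta>\<in>{0..1}. \<forall>ns\<in>perron_args l. \<infinity> \<in> set ns \<longrightarrow> f \<alpha> \<beta> ns = I)) \<and>
     (\<forall>ns\<in>perron_args l. \<infinity> \<notin> set ns \<longrightarrow>
        continuous_on ({0..1} \<times> {0..1}) (\<lambda>(\<alpha>, \<beta>). f \<alpha> \<beta> ns))"

definition perron_val :: "nat \<Rightarrow> perron_fun \<Rightarrow> (int \<Rightarrow> nat) \<Rightarrow> int \<Rightarrow> ereal" where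
  "perron_val l f a k =
     f (alpha_cf a (k + int l - 1)) (beta_cf a k) (map (\<lambda>i. enat (a (k + int i))) [0..<l])"

definition pos_seqs :: "(int \<Rightarrow> nat) set" where
  "pos_seqs = {a. \<forall>k. 1 \<le> a k}"

definition periodic_seqs :: "(int \<Rightarrow> nat) set" where
  "periodic_seqs = {a \<in> pos_seqs. \<exists>p>0. \<forall>k. a (k + p) = a k}"

text \<open>The filter of \<open>\<bar>k\<bar> \<rightarrow> \<infinity>\<close> on the integers.\<close>

definition abs_at_top :: "int filter" where
  "abs_at_top = filtercomap abs at_top"

definition sigma_liminf :: "nat \<Rightarrow> perron_fun \<Rightarrow> ereal set" where
  "sigma_liminf l f = {Liminf abs_at_top (perron_val l f a) | a. a \<in> pos_seqs}"

definition sigma_limsup :: "nat \<Rightarrow> perron_fun \<Rightarrow> ereal set" where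
  "sigma_limsup l f = {Limsup abs_at_top (perron_val l f a) | a. a \<in> pos_seqs}"

definition tau_liminf :: "nat \<Rightarrow> perron_fun \<Rightarrow> ereal set" where
  "tau_liminf l f = {Liminf abs_at_top (perron_val l f a) | a. a \<in> periodic_seqs}"

definition tau_limsup :: "nat \<Rightarrow> perron_fun \<Rightarrow> ereal set" where
  "tau_limsup l f = {Limsup abs_at_top (perron_val l f a) | a. a \<in> periodic_seqs}"

end

theory Submission
  imports Defs
begin

text \<open>
  Coding \<open>a\<close> by the sequence \<open>x\<^sub>i = 1 / a\<^sub>i\<close> turns the statement into one about a continuous function on
  a compact shift space. The continued fraction \<open>[0; a\<^sub>1, a\<^sub>2, \<dots>]\<close> becomes the iteration of
  \<open>t \<mapsto> x / (1 + x t)\<close>, which makes sense on all of \<open>[0,1]\<close> and for \<open>x = 0\<close> truncates the fraction, as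
  the partial quotient \<open>\<infinity>\<close> should. Two such steps contract by the factor \<open>1/4\<close>, so the truncations
  converge uniformly and the value depends continuously on the whole sequence. The alphabet
  \<open>A = {0} \<union> {1, 1/2, 1/3, \<dots>}\<close> is compact, and good continuity provides
  \<open>P\<^sub>k = F (shift k x)\<close> with a continuous function \<open>F\<close> on the compact space \<open>A\<^sup>\<int>\<close>
  (\<open>continuous_on_coded_perron\<close>): at letters other than \<open>0\<close> the alphabet is discrete, so condition
  (ii) suffices; near a letter \<open>0\<close> condition (i) takes over.

  For a continuous \<open>F\<close> on \<open>A\<^sup>\<int>\<close> and sequences over any \<open>A0 \<subseteq> A\<close>, the superior limits along all
  sequences form the closure of those along periodic ones (\<open>Limsup_spectrum_eq_closure\<close>). By
  compactness, sequences that agree up to a small error on a long window around \<open>0\<close> have nearly the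
  same value of \<open>F\<close> (\<open>near_separates\<close>).

  Every superior limit is a limit of periodic ones: choose places \<open>k < k + p\<close> far out at which \<open>x\<close> looks
  almost the same and at which \<open>F\<close> almost attains the superior limit, and repeat the word between
  them. Each window of the periodic sequence is almost a window of \<open>x\<close> far out, so no larger values
  arise, while the value at the seam is almost kept.

  Conversely, let periodic sequences \<open>b\<^sub>m\<close> have superior limits converging to \<open>L\<close>. Shift each so that
  it attains its superior limit at \<open>0\<close>, and pass to a subsequence that converges, so that consecutive
  members nearly agree on long windows around \<open>0\<close>. A single sequence that switches from \<open>b\<^sub>m\<close> to
  \<open>b\<^bsub>m+1\<^esub>\<close> at a place \<open>\<plusminus>t\<^sub>m\<close> divisible by both periods, where both look as they do around \<open>0\<close>,
  has no bad windows at the seams (\<open>switching_sequence\<close>), and it has superior limit \<open>L\<close>.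

  Inferior limits follow by passing from \<open>f\<close> to \<open>- f\<close>.
\<close>

section \<open>Windows in shift spaces\<close>

definition shift :: "int \<Rightarrow> (int \<Rightarrow> 'b) \<Rightarrow> int \<Rightarrow> 'b" where
  "shift k x = (\<lambda>i. x (k + i))"

lemma shift_apply [simp]: "shift k x i = x (k + i)"
  by (simp add: shift_def)

lemma shift_shift [simp]: "shift j (shift k x) = shift (k + j) x"
  by (simp add: shift_def fun_eq_iff add.assoc)

definition full_shift :: "'b set \<Rightarrow> (int \<Rightarrow> 'b) set" where
  "full_shift A = {x. \<forall>k. x k \<in> A}"

definition periodic_points :: "'b set \<Rightarrow> (int \<Rightarrow> 'b) set" where
  "periodic_points A = {x \<in> full_shift A. \<exists>p>0. \<forall>k. x (k + p) = x k}"

text \<open>One parameter controls both the length of the window and the error. Since \<open>near N\<close> becomes finer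
  as \<open>N\<close> grows, the relations \<open>near N\<close> generate the uniformity of the product topology.\<close>

definition near :: "nat \<Rightarrow> (int \<Rightarrow> 'b::metric_space) \<Rightarrow> (int \<Rightarrow> 'b) \<Rightarrow> bool" where
  "near N x y \<longleftrightarrow> (\<forall>s. \<bar>s\<bar> \<le> int N \<longrightarrow> dist (x s) (y s) < 1 / (real N + 1))"

lemma near_sym: "near N x y \<Longrightarrow> near N y x"
  by (simp add: near_def dist_commute)

lemma near_mono:
  assumes "near M x y" "N \<le> M"
  shows "near N x y"
  unfolding near_def
proof (intro allI impI)
  fix s :: int assume "\<bar>s\<bar> \<le> int N"
  then have "dist (x s) (y s) < 1 / (real M + 1)"
    using assms by (auto simp: near_def)
  also have "\<dots> \<le> 1 / (real N + 1)"
    using assms(2) by (simp add: frac_le)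
  finally show "dist (x s) (y s) < 1 / (real N + 1)" .
qed

lemma tendsto_fun_iff:
  fixes x :: "nat \<Rightarrow> 'a \<Rightarrow> 'b::topological_space"
  shows "x \<longlonglongrightarrow> w \<longleftrightarrow> (\<forall>i. (\<lambda>n. x n i) \<longlonglongrightarrow> w i)"
  using limitin_componentwise[of "\<lambda>_. euclidean" UNIV x w sequentially]
  by (simp add: euclidean_product_topology)

lemma compact_full_shift:
  fixes A :: "'b::topological_space set"
  assumes "compact A"
  shows "compact (full_shift A)"
proof -
  have "full_shift A = (\<Pi>\<^sub>E i\<in>UNIV. A)"
    by (auto simp: full_shift_def PiE_def)
  then show ?thesis
    using assms compactin_PiE[of "\<lambda>_. euclidean" UNIV "\<lambda>_. A"]
    by (simp add: euclidean_product_topology)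
qed

lemma full_shift_seq_compact:
  fixes A :: "'b::metric_space set"
  assumes "compact A" "\<And>n::nat. x n \<in> full_shift A"
  obtains r w where "strict_mono (r::nat \<Rightarrow> nat)" "w \<in> full_shift A" "(x \<circ> r) \<longlonglongrightarrow> w"
  using compact_imp_seq_compact[OF compact_full_shift[OF assms(1)]] assms(2)
  unfolding seq_compact_def by metis

text \<open>Coordinatewise convergence is uniform on each finite window.\<close>

lemma tendsto_window:
  fixes x :: "nat \<Rightarrow> int \<Rightarrow> 'b::metric_space"
  assumes "x \<longlonglongrightarrow> w" and "0 < e"
  shows "eventually (\<lambda>n. \<forall>s. \<bar>s\<bar> \<le> int N \<longrightarrow> dist (x n s) (w s) < e) sequentially"
proof -
  have "eventually (\<lambda>n. \<forall>s\<in>{- int N..int N}. dist (x n s) (w s) < e) sequentially"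
    using assms(1) \<open>0 < e\<close> by (simp add: eventually_ball_finite_distrib tendsto_fun_iff tendstoD)
  then show ?thesis
    by (rule eventually_mono) (simp add: abs_le_iff)
qed

lemma near_triangle:
  assumes "\<And>s. \<bar>s\<bar> \<le> int N \<Longrightarrow> dist (x s) (w s) < 1 / (2 * (real N + 1))"
    and "\<And>s. \<bar>s\<bar> \<le> int N \<Longrightarrow> dist (y s) (w s) < 1 / (2 * (real N + 1))"
  shows "near N x y"
  unfolding near_def
proof (intro allI impI)
  fix s :: int assume "\<bar>s\<bar> \<le> int N"
  then have "dist (x s) (y s) < 1 / (2 * (real N + 1)) + 1 / (2 * (real N + 1))"
    using assms[of s] dist_triangle2[of "x s" "y s" "w s"] by linarith
  then show "dist (x s) (y s) < 1 / (real N + 1)"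
    by (simp add: field_simps)
qed

text \<open>Uniform continuity of \<open>F\<close> in an order form that treats the infinite values of \<open>ereal\<close> like all
  others. If it failed for every \<open>N\<close>, the witnesses would accumulate at one common point \<open>w\<close>, where
  continuity would force both \<open>F w \<le> u\<close> and \<open>v \<le> F w\<close>.\<close>

lemma near_separates:
  fixes F :: "(int \<Rightarrow> 'b::metric_space) \<Rightarrow> ereal"
  assumes A: "compact A" and F: "continuous_on (full_shift A) F" and "u < v"
  obtains N where "\<And>x y. x \<in> full_shift A \<Longrightarrow> y \<in> full_shift A \<Longrightarrow> near N x y \<Longrightarrow> F x \<le> u \<Longrightarrow> F y < v"
proof (rule ccontr)
  assume "\<not> thesis"
  with that have "\<forall>N. \<exists>x y. x \<in> full_shift A \<and> y \<in> full_shift A \<and> near N x y \<and> F x \<le> u \<and> \<not> F y < v"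
    by blast
  then obtain x y where xy: "\<And>N. x N \<in> full_shift A" "\<And>N. y N \<in> full_shift A"
      "\<And>N. near N (x N) (y N)" "\<And>N. F (x N) \<le> u" "\<And>N. v \<le> F (y N)"
    by (metis not_less)
  obtain r w where r: "strict_mono r" and w: "w \<in> full_shift A" and lim: "(x \<circ> r) \<longlonglongrightarrow> w"
    by (rule full_shift_seq_compact[OF A xy(1)])
  have "(y \<circ> r) \<longlonglongrightarrow> w"
    unfolding tendsto_fun_iff
  proof
    fix s
    have xs: "(\<lambda>n. (x \<circ> r) n s) \<longlonglongrightarrow> w s"
      using lim by (simp add: tendsto_fun_iff)
    have close: "\<forall>\<^sub>F n in sequentially. dist ((y \<circ> r) n s) ((x \<circ> r) n s) \<le> inverse (real (Suc n))"
      using eventually_ge_at_top[of "nat \<bar>s\<bar>"]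
    proof eventually_elim
      case (elim n)
      then have "near n (x (r n)) (y (r n))"
        using xy(3) near_mono seq_suble[OF r] by blast
      with elim show ?case
        by (auto simp: near_def dist_commute inverse_eq_divide add.commute intro: less_imp_le)
    qed
    have "(\<lambda>n. dist ((y \<circ> r) n s) ((x \<circ> r) n s)) \<longlonglongrightarrow> 0"
      by (rule real_tendsto_sandwich[OF _ close tendsto_const LIMSEQ_inverse_real_of_nat]) simp
    from tendsto_add[OF this iffD1[OF tendsto_dist_iff xs]]
    have sum0: "(\<lambda>n. dist ((y \<circ> r) n s) ((x \<circ> r) n s) + dist ((x \<circ> r) n s) (w s))
        \<longlonglongrightarrow> 0"
      by simp
    have "(\<lambda>n. dist ((y \<circ> r) n s) (w s)) \<longlonglongrightarrow> 0"
      by (rule real_tendsto_sandwich[OF _ _ tendsto_const sum0])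
         (intro always_eventually allI zero_le_dist dist_triangle)+
    then show "(\<lambda>n. (y \<circ> r) n s) \<longlonglongrightarrow> w s"
      by (rule iffD2[OF tendsto_dist_iff])
  qed
  then have Fy: "(\<lambda>n. F ((y \<circ> r) n)) \<longlonglongrightarrow> F w"
    by (rule continuous_on_tendsto_compose[OF F]) (use w xy(2) in auto)
  have Fx: "(\<lambda>n. F ((x \<circ> r) n)) \<longlonglongrightarrow> F w"
    by (rule continuous_on_tendsto_compose[OF F lim]) (use w xy(1) in auto)
  have "v \<le> F w" by (rule LIMSEQ_le_const[OF Fy]) (simp add: xy(5))
  moreover have "F w \<le> u" by (rule LIMSEQ_le_const2[OF Fx]) (simp add: xy(4))
  ultimately show False using \<open>u < v\<close> by simp
qed

lemma eventually_abs_at_top: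
  "eventually P abs_at_top \<longleftrightarrow> (\<exists>N::nat. \<forall>k. int N \<le> \<bar>k\<bar> \<longrightarrow> P k)"
proof
  assume "eventually P abs_at_top"
  then obtain c :: int where "\<And>k. c \<le> \<bar>k\<bar> \<Longrightarrow> P k"
    unfolding abs_at_top_def eventually_filtercomap_at_top_linorder by auto
  then show "\<exists>N::nat. \<forall>k. int N \<le> \<bar>k\<bar> \<longrightarrow> P k"
    by (intro exI[of _ "nat c"]) auto
next
  assume "\<exists>N::nat. \<forall>k. int N \<le> \<bar>k\<bar> \<longrightarrow> P k"
  then show "eventually P abs_at_top"
    unfolding abs_at_top_def eventually_filtercomap_at_top_linorder by blast
qed

lemma le_Limsup_abs_at_top:
  fixes P :: "int \<Rightarrow> ereal"
  assumes "\<And>N::nat. \<exists>k. int N \<le> \<bar>k\<bar> \<and> u \<le> P k"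
  shows "u \<le> Limsup abs_at_top P"
proof (rule ccontr)
  assume "\<not> u \<le> Limsup abs_at_top P"
  then have "\<forall>\<^sub>F k in abs_at_top. P k < u"
    by (intro Limsup_lessD) simp
  then show False
    using assms unfolding eventually_abs_at_top by (meson not_less)
qed

text \<open>One of the two ends of \<open>\<int>\<close> already carries the superior limit, so that places where it is almost
  attained can be taken at the same end, with only far out places between any two of them.\<close>

lemma Limsup_abs_at_top_one_sided:
  fixes P :: "int \<Rightarrow> ereal"
  obtains e :: int where "e = 1 \<or> e = -1" "Limsup abs_at_top P = limsup (\<lambda>n. P (e * int n))"
proof -
  define L where "L e = limsup (\<lambda>n. P (e * int n))" for e
  have le: "L e \<le> Limsup abs_at_top P" if "e = 1 \<or> e = -1" for e
    unfolding L_def Limsup_le_iff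
  proof (intro allI impI)
    fix y assume "Limsup abs_at_top P < y"
    then obtain N :: nat where "\<And>k. int N \<le> \<bar>k\<bar> \<Longrightarrow> P k < y"
      using Limsup_lessD eventually_abs_at_top by metis
    then show "\<forall>\<^sub>F n in sequentially. P (e * int n) < y"
      using that by (intro eventually_sequentiallyI[of N]) auto
  qed
  have "Limsup abs_at_top P \<le> max (L 1) (L (-1))"
    unfolding Limsup_le_iff
  proof (intro allI impI)
    fix y assume "max (L 1) (L (-1)) < y"
    then have "\<forall>\<^sub>F n in sequentially. P (1 * int n) < y \<and> P ((-1) * int n) < y"
      unfolding L_def by (intro eventually_conj Limsup_lessD) auto
    then obtain N where N: "\<And>n. N \<le> n \<Longrightarrow> P (int n) < y \<and> P (- int n) < y"
      by (auto simp: eventually_sequentially)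
    have "P k < y" if "int N \<le> \<bar>k\<bar>" for k
      using N[of "nat \<bar>k\<bar>"] that by (cases "0 \<le> k") auto
    then show "\<forall>\<^sub>F k in abs_at_top. P k < y"
      unfolding eventually_abs_at_top by blast
  qed
  with le[of 1] le[of "-1"] have "Limsup abs_at_top P = L 1 \<or> Limsup abs_at_top P = L (-1)"
    by (auto simp: max_def split: if_splits)
  then show thesis
    using that unfolding L_def by blast
qed

lemma shift_in_full_shift [simp]: "x \<in> full_shift A \<Longrightarrow> shift k x \<in> full_shift A"
  by (simp add: full_shift_def)

lemma full_shift_mono: "A \<subseteq> B \<Longrightarrow> full_shift A \<subseteq> full_shift B"
  by (auto simp: full_shift_def)

lemma periodic_multiple:
  fixes x :: "int \<Rightarrow> 'b"
  assumes "\<And>k. x (k + p) = x k" "p dvd d"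
  shows "x (k + d) = x k"
proof -
  have nat: "x (k + p * int n) = x k" for k n
  proof (induction n)
    case (Suc n)
    have "x (k + p * int (Suc n)) = x ((k + p * int n) + p)"
      by (simp add: algebra_simps)
    with Suc show ?case by (simp add: assms(1))
  qed auto
  obtain c where c: "d = p * c" using assms(2) by auto
  show ?thesis
  proof (cases "0 \<le> c")
    case True
    then show ?thesis using nat[of k "nat c"] c by simp
  next
    case False
    then show ?thesis using nat[of "k + d" "nat (- c)"] c by simp
  qed
qed

text \<open>Along a periodic sequence only finitely many values occur, each of them infinitely often.\<close>

lemma periodic_Limsup_attained:
  fixes F :: "(int \<Rightarrow> 'b) \<Rightarrow> ereal"
  assumes "x \<in> periodic_points A"
  obtains n where "Limsup abs_at_top (\<lambda>k. F (shift k x)) = F (shift n x)"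
    "\<And>k. F (shift k x) \<le> F (shift n x)"
proof -
  obtain p where p: "p > 0" "\<And>k. x (k + p) = x k"
    using assms by (auto simp: periodic_points_def)
  define V where "V = (\<lambda>k. F (shift k x)) ` {0..<p}"
  have V: "finite V" "V \<noteq> {}"
    using p(1) by (auto simp: V_def)
  obtain n where n: "F (shift n x) = Max V"
    using Max_in[OF V] by (auto simp: V_def)
  have per: "shift k x = shift l x" if "p dvd k - l" for k l
  proof
    fix i
    show "shift k x i = shift l x i"
      using periodic_multiple[of x p "k - l" "l + i", OF p(2) that] by (simp add: algebra_simps)
  qed
  have le: "F (shift k x) \<le> F (shift n x)" for k
  proof -
    have "F (shift k x) = F (shift (k mod p) x)"
      by (subst per[of k "k mod p"]) (auto simp: mod_eq_dvd_iff [symmetric])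
    then have "F (shift k x) \<in> V"
      using p(1) by (auto simp: V_def)
    with V n show ?thesis by simp
  qed
  have "Limsup abs_at_top (\<lambda>k. F (shift k x)) = F (shift n x)"
  proof (rule antisym)
    show "Limsup abs_at_top (\<lambda>k. F (shift k x)) \<le> F (shift n x)"
      by (rule Limsup_bounded) (simp add: le)
    show "F (shift n x) \<le> Limsup abs_at_top (\<lambda>k. F (shift k x))"
    proof (rule le_Limsup_abs_at_top)
      fix N :: nat
      define k where "k = n + p * (int N + \<bar>n\<bar>)"
      have "int N + \<bar>n\<bar> \<le> p * (int N + \<bar>n\<bar>)"
        using p(1) mult_right_mono[of 1 p "int N + \<bar>n\<bar>"] by simp
      then have "int N \<le> \<bar>k\<bar>" unfolding k_def by linarith
      moreover have "shift k x = shift n x"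
        by (rule per) (simp add: k_def)
      ultimately show "\<exists>k. int N \<le> \<bar>k\<bar> \<and> F (shift n x) \<le> F (shift k x)"
        by (intro exI[of _ k]) simp
    qed
  qed
  with le that show thesis by blast
qed

text \<open>The periodic sequence with period word \<open>x k, \<dots>, x (k + p - 1)\<close> shadows that word. A window
  of radius \<open>m < p\<close> centred in one copy of the word reaches at most \<open>m\<close> places into the adjacent
  copies, and there the assumption exchanges the entries near \<open>k\<close> for those near \<open>k + p\<close>.\<close>

lemma splice_near:
  fixes x :: "int \<Rightarrow> 'b::metric_space"
  assumes p: "int m < p" and near: "near m (shift k x) (shift (k + p) x)"
  shows "near m (shift n (\<lambda>i. x (k + i mod p))) (shift (k + n mod p) x)"
  unfolding near_def
proof (intro allI impI)
  fix s :: int assume s: "\<bar>s\<bar> \<le> int m"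
  define q where "q = n mod p"
  have q: "0 \<le> q" "q < p" using p by (auto simp: q_def)
  have mod: "(n + s) mod p = (q + s) mod p" by (simp add: q_def mod_add_left_eq)
  have close: "dist (x (k + t)) (x (k + p + t)) < 1 / (real m + 1)" if "\<bar>t\<bar> \<le> int m" for t
    using near that by (auto simp: near_def)
  consider "q + s < 0" | "0 \<le> q + s" "q + s < p" | "p \<le> q + s" by linarith
  then have "dist (x (k + (q + s) mod p)) (x (k + q + s)) < 1 / (real m + 1)"
  proof cases
    case 1
    have "(q + s) mod p = (q + s + p) mod p" by simp
    also have "\<dots> = q + s + p" using 1 q s p by (intro mod_pos_pos_trivial) auto
    finally have eq: "(q + s) mod p = q + s + p" .
    have "dist (x (k + (q + s))) (x (k + p + (q + s))) < 1 / (real m + 1)"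
      by (rule close) (use 1 q s in linarith)
    moreover have "k + p + (q + s) = k + (q + s + p)" "k + (q + s) = k + q + s" by linarith+
    ultimately show ?thesis unfolding eq by (metis dist_commute)
  next
    case 2
    then have "(q + s) mod p = q + s" by (rule mod_pos_pos_trivial)
    then show ?thesis by (simp add: add.assoc)
  next
    case 3
    have "(q + s) mod p = (q + s - p) mod p" by simp
    also have "\<dots> = q + s - p" using 3 q s p by (intro mod_pos_pos_trivial) auto
    finally have eq: "(q + s) mod p = q + s - p" .
    have "dist (x (k + (q + s - p))) (x (k + p + (q + s - p))) < 1 / (real m + 1)"
      by (rule close) (use 3 q s in linarith)
    moreover have "k + p + (q + s - p) = k + q + s" by linarith
    ultimately show ?thesis unfolding eq by metis
  qed
  then have "dist (x (k + (n + s) mod p)) (x (k + n mod p + s)) < 1 / (real m + 1)"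
    unfolding mod by (simp only: q_def)
  then show "dist (shift n (\<lambda>i. x (k + i mod p)) s) (shift (k + n mod p) x s) < 1 / (real m + 1)"
    by (simp only: shift_apply)
qed

section \<open>Superior limits are limits of periodic ones\<close>

text \<open>Sequential compactness makes the translates at which the superior limit is almost attained return
  close to each other. The word between two such places is to become the period of a periodic
  sequence, so they must be more than \<open>m\<close> apart and all places between them far out.\<close>

lemma recurrent_window:
  fixes F :: "(int \<Rightarrow> 'b::metric_space) \<Rightarrow> ereal"
  assumes A: "compact A" and x: "x \<in> full_shift A"
  obtains k p :: "nat \<Rightarrow> int" where
    "\<And>m. int m < p m" "\<And>m q. k m \<le> q \<Longrightarrow> q < k m + p m \<Longrightarrow> int m \<le> \<bar>q\<bar>"
    "\<And>m. near m (shift (k m) x) (shift (k m + p m) x)"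
    "(\<lambda>m. F (shift (k m) x)) \<longlonglongrightarrow> Limsup abs_at_top (\<lambda>k. F (shift k x))"
proof -
  let ?L = "Limsup abs_at_top (\<lambda>k. F (shift k x))"
  obtain e :: int where e: "e = 1 \<or> e = -1" and L: "?L = limsup (\<lambda>n. F (shift (e * int n) x))"
    using Limsup_abs_at_top_one_sided by blast
  obtain r0 where r0: "strict_mono (r0 :: nat \<Rightarrow> nat)"
      "((\<lambda>n. F (shift (e * int n) x)) \<circ> r0) \<longlonglongrightarrow> ?L"
    using limsup_subseq_lim[of "\<lambda>n. F (shift (e * int n) x)"] L by metis
  obtain r1 w where r1: "strict_mono r1" "w \<in> full_shift A"
      "((\<lambda>n. shift (e * int (r0 n)) x) \<circ> r1) \<longlonglongrightarrow> w"
    by (rule full_shift_seq_compact[OF A shift_in_full_shift[OF x]])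
  define r where "r = r0 \<circ> r1"
  define t where "t n = e * int (r n)" for n
  have r: "strict_mono r" unfolding r_def using r0(1) r1(1) by (rule strict_mono_o)
  have tw: "(\<lambda>n. shift (t n) x) \<longlonglongrightarrow> w"
    using r1(3) by (simp add: t_def r_def o_def)
  have tL: "(\<lambda>n. F (shift (t n) x)) \<longlonglongrightarrow> ?L"
    using LIMSEQ_subseq_LIMSEQ[OF r0(2) r1(1)] by (simp add: t_def r_def o_def)
  have gap: "r i + d \<le> r (i + d)" for i d
  proof (induction d)
    case (Suc d)
    then show ?case using strict_monoD[OF r, of "i + d" "i + Suc d"] by simp
  qed simp
  have "\<exists>k p n. int m < p \<and> (\<forall>q. k \<le> q \<and> q < k + p \<longrightarrow> int m \<le> \<bar>q\<bar>) \<and>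
      near m (shift k x) (shift (k + p) x) \<and> k = t n \<and> m \<le> n" for m
  proof -
    obtain n0 where n0: "\<And>n s. n0 \<le> n \<Longrightarrow> \<bar>s\<bar> \<le> int m \<Longrightarrow>
        dist (shift (t n) x s) (w s) < 1 / (2 * (real m + 1))"
      using tendsto_window[OF tw, of "1 / (2 * (real m + 1))" m]
      unfolding eventually_sequentially by (auto simp: add_pos_nonneg)
    \<comment> \<open>The sequence \<open>t\<close> moves by at least one per index, so this gap makes the places more than \<open>m\<close> apart.\<close>
    define i j where "i = max n0 m" and "j = i + Suc m"
    have near: "near m (shift (t i) x) (shift (t j) x)"
      using n0 by (intro near_triangle[of m _ w]) (auto simp: i_def j_def)
    have rij: "r i + Suc m \<le> r j" "m \<le> r i"
      using gap[of i "Suc m"] seq_suble[OF r, of i] by (auto simp: i_def j_def)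
    have ij: "m \<le> i" "m \<le> j" by (auto simp: i_def j_def)
    \<comment> \<open>The left one of the two places is \<open>t i\<close> at the right end of \<open>\<int>\<close> and \<open>t j\<close> at the left end.\<close>
    show ?thesis
    proof (cases "e = 1")
      case True
      then have t: "t l = int (r l)" for l by (simp add: t_def)
      show ?thesis
      proof (intro exI conjI allI impI)
        show "int m < t j - t i" using rij by (simp add: t)
        show "int m \<le> \<bar>q\<bar>" if "t i \<le> q \<and> q < t i + (t j - t i)" for q
          using that rij by (simp add: t)
        show "near m (shift (t i) x) (shift (t i + (t j - t i)) x)" using near by simp
        show "t i = t i" "m \<le> i" using ij by simp_all
      qed
    next
      case False
      with e have t: "t l = - int (r l)" for l by (simp add: t_def)
      show ?thesis
      proof (intro exI conjI allI impI)
        show "int m < t i - t j" using rij by (simp add: t)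
        show "int m \<le> \<bar>q\<bar>" if "t j \<le> q \<and> q < t j + (t i - t j)" for q
          using that rij by (simp add: t)
        show "near m (shift (t j) x) (shift (t j + (t i - t j)) x)" using near_sym[OF near] by simp
        show "t j = t j" "m \<le> j" using ij by simp_all
      qed
    qed
  qed
  then obtain k p n where kp: "\<And>m. int m < p m"
      "\<And>m q. k m \<le> q \<Longrightarrow> q < k m + p m \<Longrightarrow> int m \<le> \<bar>q\<bar>"
      "\<And>m. near m (shift (k m) x) (shift (k m + p m) x)"
    and n: "\<And>m. k m = t (n m)" "\<And>m. m \<le> n m"
    by metis
  have "filterlim n at_top sequentially"
    using n(2) by (intro filterlim_at_top_mono[OF filterlim_ident]) auto
  then have lim: "(\<lambda>m. F (shift (k m) x)) \<longlonglongrightarrow> ?L"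
    using filterlim_compose[OF tL] by (simp add: n(1))
  show thesis by (rule that[of p k]) (fact kp lim)+
qed

proposition Limsup_in_closure_periodic:
  fixes F :: "(int \<Rightarrow> 'b::metric_space) \<Rightarrow> ereal"
  assumes A: "compact A" "A0 \<subseteq> A" and F: "continuous_on (full_shift A) F"
    and x: "x \<in> full_shift A0"
  shows "Limsup abs_at_top (\<lambda>k. F (shift k x)) \<in>
    closure {Limsup abs_at_top (\<lambda>k. F (shift k y)) | y. y \<in> periodic_points A0}"
    (is "?L \<in> closure ?T")
proof -
  have sub: "full_shift A0 \<subseteq> full_shift A" using A(2) by (rule full_shift_mono)
  then have xA: "x \<in> full_shift A" using x by auto
  obtain k p where p: "\<And>m. int m < p m"
    and far: "\<And>m q. k m \<le> q \<Longrightarrow> q < k m + p m \<Longrightarrow> int m \<le> \<bar>q\<bar>"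
    and rec: "\<And>m. near m (shift (k m) x) (shift (k m + p m) x)"
    and lim: "(\<lambda>m. F (shift (k m) x)) \<longlonglongrightarrow> ?L"
    using recurrent_window[OF A(1) xA, of F] by metis
  \<comment> \<open>Between \<open>k m\<close> and \<open>k m + p m\<close> the sequence \<open>x\<close> is far out, so \<open>F\<close> is almost bounded by \<open>?L\<close> there;
    shadowing carries this bound over to all translates of \<open>b m\<close>.\<close>
  define b where "b m = (\<lambda>i. x (k m + i mod p m))" for m
  define c where "c m = Limsup abs_at_top (\<lambda>n. F (shift n (b m)))" for m
  have p0: "0 < p m" for m using p[of m] by linarith
  have b0: "b m \<in> full_shift A0" for m
    using x by (auto simp: b_def full_shift_def)
  have "b m (i + p m) = b m i" for m i by (simp add: b_def)
  then have "b m \<in> periodic_points A0" for m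
    using b0 p0 unfolding periodic_points_def by blast
  then have cT: "c m \<in> ?T" for m unfolding c_def by blast
  have bA: "shift n (b m) \<in> full_shift A" for m n using b0 sub by auto
  have near: "near m (shift n (b m)) (shift (k m + n mod p m) x)" for m n
    unfolding b_def by (rule splice_near[OF p rec])
  have "c \<longlonglongrightarrow> ?L"
  proof (rule order_tendstoI)
    fix v assume "?L < v"
    then obtain v1 v2 where v: "?L < v1" "v1 < v2" "v2 < v" using dense by metis
    obtain N where N: "\<And>x y. x \<in> full_shift A \<Longrightarrow> y \<in> full_shift A \<Longrightarrow> near N x y \<Longrightarrow> F x \<le> v1 \<Longrightarrow> F y < v2"
      using near_separates[OF A(1) F v(2)] by metis
    obtain M :: nat where M: "\<And>q. int M \<le> \<bar>q\<bar> \<Longrightarrow> F (shift q x) < v1"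
      using Limsup_lessD[OF v(1)] unfolding eventually_abs_at_top by blast
    show "\<forall>\<^sub>F m in sequentially. c m < v"
      using eventually_ge_at_top[of "max N M"]
    proof eventually_elim
      case (elim m)
      have "F (shift n (b m)) < v2" for n
      proof (rule N)
        show "near N (shift (k m + n mod p m) x) (shift n (b m))"
          using near near_sym near_mono elim by (metis max.bounded_iff)
        show "F (shift (k m + n mod p m) x) \<le> v1"
          using far[of m "k m + n mod p m"] elim p0[of m] by (intro M[THEN less_imp_le]) auto
      qed (use bA xA in auto)
      then have "\<forall>n. F (shift n (b m)) \<le> v2" by (blast intro: less_imp_le)
      then have "c m \<le> v2" unfolding c_def by (intro Limsup_bounded always_eventually)
      with v show ?case by simp
    qed
  next
    fix u assume "u < ?L"
    then obtain u1 u2 where u: "u < u1" "u1 < u2" "u2 < ?L" using dense by metis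
    obtain N where N: "\<And>x y. x \<in> full_shift A \<Longrightarrow> y \<in> full_shift A \<Longrightarrow> near N x y \<Longrightarrow> F x \<le> u1 \<Longrightarrow> F y < u2"
      using near_separates[OF A(1) F u(2)] by metis
    show "\<forall>\<^sub>F m in sequentially. u < c m"
      using eventually_ge_at_top[of N] order_tendstoD(1)[OF lim u(3)]
    proof eventually_elim
      case (elim m)
      have "u1 \<le> c m" unfolding c_def
      proof (rule le_Limsup_abs_at_top)
        fix M :: nat
        \<comment> \<open>Translating by a multiple of the period puts a seam at \<open>0\<close>, where \<open>F\<close> has almost the value \<open>?L\<close>.\<close>
        define n where "n = int M * p m"
        have nm: "near N (shift n (b m)) (shift (k m) x)"
          using near_mono[OF near[of m n] elim(1)] by (simp add: n_def)
        have "\<not> F (shift n (b m)) \<le> u1"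
          using N[OF bA _ nm] xA elim(2) by (auto dest: less_asym)
        moreover have "int M \<le> \<bar>n\<bar>"
          using p0[of m] mult_left_mono[of 1 "p m" "int M"] by (simp add: n_def)
        ultimately show "\<exists>n. int M \<le> \<bar>n\<bar> \<and> u1 \<le> F (shift n (b m))" by force
      qed
      with u show ?case by simp
    qed
  qed
  then have "(\<forall>m. c m \<in> ?T) \<and> c \<longlonglongrightarrow> ?L" using cT by (intro conjI allI)
  then show ?thesis unfolding closure_sequential by (rule exI[of _ c])
qed

section \<open>Limits of periodic values are attained\<close>

text \<open>The sequence \<open>x\<close> equals \<open>B 0\<close> around \<open>0\<close> and changes from \<open>B m\<close> to \<open>B (Suc m)\<close> at \<open>\<plusminus>t m\<close>. As \<open>t m\<close> is a
  common multiple of both periods, near \<open>\<plusminus>t m\<close> these sequences look as they do near \<open>0\<close>, where they are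
  close to each other. Hence from \<open>t j\<close> up to \<open>t (Suc j)\<close> the sequence \<open>x\<close> shadows \<open>B (Suc j)\<close> even
  across the seams.\<close>

lemma switching_sequence:
  fixes B :: "nat \<Rightarrow> int \<Rightarrow> 'b::metric_space" and p :: "nat \<Rightarrow> int"
  assumes p: "\<And>m. 0 < p m" and per: "\<And>m k. B m (k + p m) = B m k"
    and close: "\<And>m. near m (B m) (B (Suc m))"
  obtains t :: "nat \<Rightarrow> int" and x :: "int \<Rightarrow> 'b" where
    "strict_mono t" "\<And>m. int m < t m" "\<And>m. shift (t m) (B (Suc m)) = B (Suc m)"
    "\<And>k. x k \<in> range (\<lambda>m. B m k)"
    "\<And>j k. 1 \<le> j \<Longrightarrow> t j \<le> \<bar>k\<bar> \<Longrightarrow> \<bar>k\<bar> < t (Suc j) \<Longrightarrow> near j (shift k (B (Suc j))) (shift k x)"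
proof -
  \<comment> \<open>The powers of two keep consecutive switching places so far apart that a window of radius \<open>j\<close> around a
    place \<open>k\<close> with \<open>t j \<le> \<bar>k\<bar> < t (Suc j)\<close> meets only the stretches of \<open>B j\<close>, \<open>B (j + 1)\<close> and \<open>B (j + 2)\<close>.\<close>
  define t where "t m = 2 ^ m * (\<Prod>i\<le>Suc m. p i)" for m
  have prod_pos: "0 < (\<Prod>i\<le>m. p i)" for m by (intro prod_pos) (use p in auto)
  have large: "int m < t m" for m
  proof -
    have "int m < 2 ^ m" by (metis of_nat_less_two_power)
    also have "\<dots> \<le> t m"
      using prod_pos[of "Suc m"] mult_left_mono[of 1 "\<Prod>i\<le>Suc m. p i" "2 ^ m"]
      unfolding t_def by simp
    finally show ?thesis .
  qed
  have double: "2 * t m \<le> t (Suc m)" for m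
  proof -
    have "1 \<le> p (Suc (Suc m))" using p[of "Suc (Suc m)"] by simp
    moreover have "0 \<le> 2 * t m" using large[of m] by simp
    ultimately have "2 * t m * 1 \<le> 2 * t m * p (Suc (Suc m))" by (rule mult_left_mono)
    also have "\<dots> = t (Suc m)" by (simp add: t_def mult_ac)
    finally show ?thesis by simp
  qed
  have mono: "strict_mono t"
    unfolding strict_mono_Suc_iff using double large by (smt (verit) of_nat_0_le_iff)
  have dvd: "p i dvd t m" if "i \<le> Suc m" for i m
    unfolding t_def by (rule dvd_mult, rule dvd_prodI) (use that in auto)
  have at_t: "B i (s + t m) = B i s" if "i \<le> Suc m" for i m s
    by (rule periodic_multiple[of "B i" "p i", OF per dvd[OF that]])
  have at_t': "B i (s - t m) = B i s" if "i \<le> Suc m" for i m s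
    using at_t[OF that, of "s - t m"] by simp
  have seam: "dist (B i q) (B (Suc i) q) < 1 / (real i + 1)" if "\<bar>\<bar>q\<bar> - t i\<bar> \<le> int i" for i q
  proof (cases "0 \<le> q")
    case True
    then have "dist (B i (q - t i)) (B (Suc i) (q - t i)) < 1 / (real i + 1)"
      using close[of i] that by (auto simp: near_def)
    then show ?thesis by (simp add: at_t')
  next
    case False
    then have "\<bar>q + t i\<bar> \<le> int i" using that by linarith
    then have "dist (B i (q + t i)) (B (Suc i) (q + t i)) < 1 / (real i + 1)"
      using close[of i] by (auto simp: near_def)
    then show ?thesis by (simp add: at_t)
  qed
  define lev where "lev k = (LEAST m. \<bar>k\<bar> < t m)" for k :: int
  define x where "x k = B (lev k) k" for k
  have lev: "lev k = Suc j" if "t j \<le> \<bar>k\<bar>" "\<bar>k\<bar> < t (Suc j)" for j k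
    unfolding lev_def
  proof (rule Least_equality)
    show "\<bar>k\<bar> < t (Suc j)" by (rule that(2))
    fix m assume "\<bar>k\<bar> < t m"
    with that(1) have "t j < t m" by simp
    then show "Suc j \<le> m" using strict_mono_less[OF mono] by simp
  qed
  show thesis
  proof (rule that[OF mono large])
    show "shift (t m) (B (Suc m)) = B (Suc m)" for m
      by (rule ext) (simp add: add.commute[of "t m"] at_t)
    show "x k \<in> range (\<lambda>m. B m k)" for k by (simp add: x_def)
    fix j k assume j: "1 \<le> j" and k: "t j \<le> \<bar>k\<bar>" "\<bar>k\<bar> < t (Suc j)"
    show "near j (shift k (B (Suc j))) (shift k x)"
      unfolding near_def shift_apply
    proof (intro allI impI)
      fix s :: int assume s: "\<bar>s\<bar> \<le> int j"
      define q where "q = k + s"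
      have q: "\<bar>k\<bar> - int j \<le> \<bar>q\<bar>" "\<bar>q\<bar> \<le> \<bar>k\<bar> + int j"
        using s unfolding q_def by linarith+
      obtain i where i: "j = Suc i" using j by (cases j) auto
      consider "\<bar>q\<bar> < t j" | "t j \<le> \<bar>q\<bar>" "\<bar>q\<bar> < t (Suc j)" | "t (Suc j) \<le> \<bar>q\<bar>" by linarith
      then have "dist (B (Suc j) q) (x q) < 1 / (real j + 1)"
      proof cases
        case 1
        have "t i \<le> \<bar>q\<bar>" using double[of i] large[of i] q k(1) i by simp
        with 1 have "lev q = j" using lev[of i q] i by simp
        moreover have "\<bar>\<bar>q\<bar> - t j\<bar> \<le> int j" using 1 q k by linarith
        ultimately show ?thesis using seam[of q j] by (simp add: x_def dist_commute)
      next
        case 2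
        then show ?thesis using lev[of j q] by (simp add: x_def)
      next
        case 3
        have "\<bar>q\<bar> < t (Suc (Suc j))" using double[of "Suc j"] large[of "Suc j"] q k by simp
        with 3 have "lev q = Suc (Suc j)" by (rule lev)
        moreover have "\<bar>\<bar>q\<bar> - t (Suc j)\<bar> \<le> int (Suc j)" using 3 q k by linarith
        ultimately have "dist (B (Suc j) q) (x q) < 1 / (real (Suc j) + 1)"
          using seam[of q "Suc j"] by (simp add: x_def)
        also have "\<dots> \<le> 1 / (real j + 1)" by (simp add: frac_le)
        finally show ?thesis .
      qed
      then show "dist (B (Suc j) (k + s)) (x (k + s)) < 1 / (real j + 1)" by (simp add: q_def)
    qed
  qed
qed

text \<open>After a shift the superior limit of each periodic sequence is its value at the translate \<open>0\<close>, and
  a convergent subsequence has consecutive members as close as desired.\<close>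

lemma convergent_maximal_periodic:
  fixes F :: "(int \<Rightarrow> 'b::metric_space) \<Rightarrow> ereal"
  assumes A: "compact A" "A0 \<subseteq> A"
    and L: "L \<in> closure {Limsup abs_at_top (\<lambda>k. F (shift k y)) | y. y \<in> periodic_points A0}"
  obtains B where "\<And>m. B m \<in> periodic_points A0" "\<And>m k. F (shift k (B m)) \<le> F (B m)"
    "(\<lambda>m. F (B m)) \<longlonglongrightarrow> L" "\<And>m. near m (B m) (B (Suc m))"
proof -
  obtain c where "\<And>n::nat. c n \<in> {Limsup abs_at_top (\<lambda>k. F (shift k y)) | y. y \<in> periodic_points A0}"
      and cL: "c \<longlonglongrightarrow> L"
    using L unfolding closure_sequential by blast
  then have "\<forall>n. \<exists>y. y \<in> periodic_points A0 \<and> c n = Limsup abs_at_top (\<lambda>k. F (shift k y))"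
    by blast
  then obtain y where y: "\<And>n. y n \<in> periodic_points A0"
      "\<And>n. c n = Limsup abs_at_top (\<lambda>k. F (shift k (y n)))"
    by metis
  have "\<exists>h. c n = F (shift h (y n)) \<and> (\<forall>k. F (shift k (y n)) \<le> F (shift h (y n)))" for n
    using periodic_Limsup_attained[OF y(1)[of n], of F] y(2)[of n] by metis
  then obtain h where h: "\<And>n. c n = F (shift (h n) (y n))"
      "\<And>n k. F (shift k (y n)) \<le> F (shift (h n) (y n))"
    by metis
  define b where "b n = shift (h n) (y n)" for n
  have b: "b n \<in> periodic_points A0" for n
    using y(1)[of n] by (auto simp: b_def periodic_points_def simp flip: add.assoc)
  have bA: "b n \<in> full_shift A" for n
    using b[of n] full_shift_mono[OF A(2)] by (auto simp: periodic_points_def)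
  obtain r w where r: "strict_mono r" "w \<in> full_shift A" "(b \<circ> r) \<longlonglongrightarrow> w"
    by (rule full_shift_seq_compact[OF A(1) bA])
  have "\<exists>n\<ge>m. \<forall>s. \<bar>s\<bar> \<le> int m \<longrightarrow> dist (b (r n) s) (w s) < 1 / (2 * (real m + 1))" for m
    using eventually_conj[OF eventually_ge_at_top[of m]
        tendsto_window[OF r(3), of "1 / (2 * (real m + 1))" m]]
    unfolding eventually_sequentially by (auto simp: add_pos_nonneg)
  then obtain n where n: "\<And>m. m \<le> n m"
      "\<And>m s. \<bar>s\<bar> \<le> int m \<Longrightarrow> dist (b (r (n m)) s) (w s) < 1 / (2 * (real m + 1))"
    by metis
  have "filterlim (\<lambda>m. r (n m)) at_top sequentially"
    by (intro filterlim_at_top_mono[OF filterlim_ident] always_eventually allI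
        order_trans[OF n(1) seq_suble[OF r(1)]])
  then have lim: "(\<lambda>m. F (b (r (n m)))) \<longlonglongrightarrow> L"
    using filterlim_compose[OF cL] by (simp add: h(1) b_def)
  have near: "near m (b (r (n m))) (b (r (n (Suc m))))" for m
  proof (rule near_triangle[of m _ w])
    fix s :: int assume s: "\<bar>s\<bar> \<le> int m"
    show "dist (b (r (n m)) s) (w s) < 1 / (2 * (real m + 1))" using n(2) s .
    have "dist (b (r (n (Suc m))) s) (w s) < 1 / (2 * (real (Suc m) + 1))"
      by (rule n(2)) (use s in simp)
    also have "\<dots> \<le> 1 / (2 * (real m + 1))" by (simp add: frac_le)
    finally show "dist (b (r (n (Suc m))) s) (w s) < 1 / (2 * (real m + 1))" .
  qed
  show thesis
    by (rule that[of "\<lambda>m. b (r (n m))", OF b _ lim near]) (simp add: b_def h(2))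
qed

proposition closure_periodic_Limsup:
  fixes F :: "(int \<Rightarrow> 'b::metric_space) \<Rightarrow> ereal"
  assumes A: "compact A" "A0 \<subseteq> A" and F: "continuous_on (full_shift A) F"
    and L: "L \<in> closure {Limsup abs_at_top (\<lambda>k. F (shift k y)) | y. y \<in> periodic_points A0}"
  obtains x where "x \<in> full_shift A0" "Limsup abs_at_top (\<lambda>k. F (shift k x)) = L"
proof -
  obtain B where B: "\<And>m. B m \<in> periodic_points A0" "\<And>m k. F (shift k (B m)) \<le> F (B m)"
    and lim: "(\<lambda>m. F (B m)) \<longlonglongrightarrow> L" and near: "\<And>m. near m (B m) (B (Suc m))"
    using convergent_maximal_periodic[OF A L] by metis
  have "\<forall>m. \<exists>p>0. \<forall>k. B m (k + p) = B m k"
    using B(1) by (auto simp: periodic_points_def)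
  then obtain p where p: "\<And>m. 0 < p m" "\<And>m k. B m (k + p m) = B m k" by metis
  obtain t x where t: "strict_mono t" "\<And>m. int m < t m"
    and returns: "\<And>m. shift (t m) (B (Suc m)) = B (Suc m)"
    and ran: "\<And>k. x k \<in> range (\<lambda>m. B m k)"
    and shadow: "\<And>j k. 1 \<le> j \<Longrightarrow> t j \<le> \<bar>k\<bar> \<Longrightarrow> \<bar>k\<bar> < t (Suc j) \<Longrightarrow> near j (shift k (B (Suc j))) (shift k x)"
    using switching_sequence[OF p near] by metis
  have B0: "B m \<in> full_shift A0" for m using B(1) by (simp add: periodic_points_def)
  have x0: "x \<in> full_shift A0"
    unfolding full_shift_def
  proof safe
    fix k
    obtain m where "x k = B m k" using ran by blast
    then show "x k \<in> A0" using B0[of m] by (simp add: full_shift_def)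
  qed
  have BA: "shift k (B m) \<in> full_shift A" and xA: "shift k x \<in> full_shift A" for m k
    using B0 x0 full_shift_mono[OF A(2)] by auto
  let ?S = "Limsup abs_at_top (\<lambda>k. F (shift k x))"
  have "?S \<le> L"
    unfolding Limsup_le_iff
  proof (intro allI impI)
    fix v assume "L < v"
    then obtain v1 where v: "L < v1" "v1 < v" using dense by metis
    obtain N where N: "\<And>x y. x \<in> full_shift A \<Longrightarrow> y \<in> full_shift A \<Longrightarrow> near N x y \<Longrightarrow> F x \<le> v1 \<Longrightarrow> F y < v"
      using near_separates[OF A(1) F v(2)] by metis
    obtain M where M: "\<And>m. M \<le> m \<Longrightarrow> F (B m) < v1"
      using order_tendstoD(2)[OF lim v(1)] by (auto simp: eventually_sequentially)
    define J where "J = Max {1, N, M}"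
    have J: "1 \<le> J" "N \<le> J" "M \<le> J" by (auto simp: J_def)
    have "F (shift k x) < v" if k: "int (nat (t J)) \<le> \<bar>k\<bar>" for k
    proof -
      have kJ: "t J \<le> \<bar>k\<bar>" using k t(2)[of J] by simp
      \<comment> \<open>The stretch between two switching places that contains \<open>k\<close>.\<close>
      define l where "l = (LEAST m. \<bar>k\<bar> < t m)"
      have "\<bar>k\<bar> < t (nat \<bar>k\<bar>)" using t(2)[of "nat \<bar>k\<bar>"] by simp
      then have l: "\<bar>k\<bar> < t l" unfolding l_def by (rule LeastI)
      with kJ have "t J < t l" by simp
      then have "J < l" by (simp add: strict_mono_less[OF t(1)])
      then obtain j where j: "l = Suc j" "J \<le> j" by (cases l) auto
      then have "\<not> \<bar>k\<bar> < t j" using not_less_Least[of j "\<lambda>m. \<bar>k\<bar> < t m"] by (simp add: l_def)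
      then have "near j (shift k (B (Suc j))) (shift k x)"
        using l j J by (intro shadow) auto
      then have "near N (shift k (B (Suc j))) (shift k x)"
        by (rule near_mono) (use J j in simp)
      moreover have "F (shift k (B (Suc j))) \<le> v1"
        using B(2)[of k "Suc j"] M[of "Suc j"] J j by simp
      ultimately show ?thesis using N BA xA by blast
    qed
    then show "\<forall>\<^sub>F k in abs_at_top. F (shift k x) < v"
      unfolding eventually_abs_at_top by blast
  qed
  moreover have "L \<le> ?S"
  proof (rule dense_le)
    fix u assume "u < L"
    then obtain u1 where u: "u < u1" "u1 < L" using dense by metis
    obtain N where N: "\<And>x y. x \<in> full_shift A \<Longrightarrow> y \<in> full_shift A \<Longrightarrow> near N x y \<Longrightarrow> F x \<le> u \<Longrightarrow> F y < u1"
      using near_separates[OF A(1) F u(1)] by metis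
    obtain M where M: "\<And>m. M \<le> m \<Longrightarrow> u1 < F (B m)"
      using order_tendstoD(1)[OF lim u(2)] by (auto simp: eventually_sequentially)
    show "u \<le> ?S"
    proof (rule le_Limsup_abs_at_top)
      fix K :: nat
      define j where "j = Max {1, N, M, K}"
      have j: "1 \<le> j" "N \<le> j" "M \<le> j" "K \<le> j" by (auto simp: j_def)
      \<comment> \<open>At the switching place \<open>t j\<close> the sequence \<open>x\<close> looks like \<open>B (Suc j)\<close> does at its maximal value.\<close>
      have "near j (shift (t j) (B (Suc j))) (shift (t j) x)"
        using j(1) t(2)[of j] strict_monoD[OF t(1), of j "Suc j"] by (intro shadow) auto
      then have "near N (shift (t j) x) (B (Suc j))"
        using near_sym near_mono j(2) returns by metis
      then have "\<not> F (shift (t j) x) \<le> u"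
        using N[OF xA BA[of 0 "Suc j"]] M[of "Suc j"] j(3) by (auto simp: shift_def dest: less_asym)
      then show "\<exists>k. int K \<le> \<bar>k\<bar> \<and> u \<le> F (shift k x)"
        using t(2)[of j] j(4) by (intro exI[of _ "t j"]) auto
    qed
  qed
  ultimately show thesis by (intro that[OF x0] antisym)
qed

theorem Limsup_spectrum_eq_closure:
  fixes F :: "(int \<Rightarrow> 'b::metric_space) \<Rightarrow> ereal"
  assumes "compact A" "A0 \<subseteq> A" "continuous_on (full_shift A) F"
  shows "{Limsup abs_at_top (\<lambda>k. F (shift k x)) | x. x \<in> full_shift A0} =
    closure {Limsup abs_at_top (\<lambda>k. F (shift k x)) | x. x \<in> periodic_points A0}"
proof (intro antisym subsetI)
  fix L assume "L \<in> {Limsup abs_at_top (\<lambda>k. F (shift k x)) | x. x \<in> full_shift A0}"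
  then show "L \<in> closure {Limsup abs_at_top (\<lambda>k. F (shift k x)) | x. x \<in> periodic_points A0}"
    using Limsup_in_closure_periodic[OF assms] by blast
next
  fix L assume "L \<in> closure {Limsup abs_at_top (\<lambda>k. F (shift k x)) | x. x \<in> periodic_points A0}"
  from closure_periodic_Limsup[OF assms this]
  show "L \<in> {Limsup abs_at_top (\<lambda>k. F (shift k x)) | x. x \<in> full_shift A0}"
    by blast
qed

section \<open>Continuity of continued fractions\<close>

definition unit_seqs :: "(nat \<Rightarrow> real) set" where
  "unit_seqs = {x. \<forall>i. x i \<in> {0..1}}"

text \<open>The continued fraction in terms of the inverses of its partial quotients, since
  \<open>1 / (s + t) = x / (1 + x t)\<close> for \<open>x = 1 / s\<close>. An entry \<open>0\<close> stands for the partial quotient \<open>\<infinity>\<close> and cuts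
  the fraction off.\<close>

primrec cf_trunc :: "nat \<Rightarrow> (nat \<Rightarrow> real) \<Rightarrow> real" where
  "cf_trunc 0 x = 0"
| "cf_trunc (Suc n) x = x 0 / (1 + x 0 * cf_trunc n (\<lambda>i. x (Suc i)))"

definition cf_inv :: "(nat \<Rightarrow> real) \<Rightarrow> real" where
  "cf_inv x = lim (\<lambda>n. cf_trunc n x)"

lemma cfrac_conv_eq_cf_trunc:
  assumes "\<And>i. 1 \<le> s i"
  shows "cfrac_conv n s = cf_trunc n (\<lambda>i. inverse (real (s i)))"
  using assms
proof (induction n arbitrary: s)
  case (Suc n)
  have "real (s 0) \<noteq> 0" using Suc.prems[of 0] by simp
  then show ?case using Suc.IH[of "\<lambda>i. s (Suc i)"] Suc.prems
    by (simp add: field_simps)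
qed simp

lemma cfrac_eq_cf_inv:
  assumes "\<And>i. 1 \<le> s i"
  shows "cfrac s = cf_inv (\<lambda>i. inverse (real (s i)))"
  unfolding cfrac_def cf_inv_def using cfrac_conv_eq_cf_trunc[OF assms] by simp

lemma unit_seqs_tail: "x \<in> unit_seqs \<Longrightarrow> (\<lambda>i. x (Suc i)) \<in> unit_seqs"
  by (simp add: unit_seqs_def)

lemma cf_trunc_bounds:
  assumes "x \<in> unit_seqs"
  shows "cf_trunc n x \<in> {0..1}"
  using assms
proof (induction n arbitrary: x)
  case (Suc n)
  have x0: "0 \<le> x 0" "x 0 \<le> 1" using Suc.prems by (auto simp: unit_seqs_def)
  have "0 \<le> x 0 * cf_trunc n (\<lambda>i. x (Suc i))"
    using Suc.IH[OF unit_seqs_tail[OF Suc.prems]] x0 by auto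
  then show ?case using x0 by (simp add: divide_le_eq)
qed simp

text \<open>A single step need not contract, as its derivative at \<open>x = 1\<close>, \<open>t = 0\<close> is \<open>-1\<close>. For two steps the
  difference of the values is \<open>s - t\<close> times the product of the factors \<open>x y / D\<close> for \<open>s\<close> and \<open>t\<close>, and
  \<open>D \<ge> 1 + x y \<ge> 2 x y\<close>.\<close>

lemma two_step_contraction:
  fixes x y s t :: real
  assumes x: "0 \<le> x" "x \<le> 1" and y: "0 \<le> y" "y \<le> 1" and st: "0 \<le> s" "0 \<le> t"
  shows "\<bar>x / (1 + x * (y / (1 + y * s))) - x / (1 + x * (y / (1 + y * t)))\<bar> \<le> \<bar>s - t\<bar> / 4"
proof -
  define D where "D r = 1 + y * r + x * y" for r
  have xy: "0 \<le> x * y" "x * y \<le> 1" using x y by (auto simp: mult_le_one)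
  have pos: "0 < 1 + y * r" "0 < D r" and half: "x * y / D r \<le> 1 / 2" if "0 \<le> r" for r
  proof -
    have "0 \<le> y * r" using y that by simp
    then show "0 < 1 + y * r" "0 < D r" unfolding D_def using xy by linarith+
    then show "x * y / D r \<le> 1 / 2"
      using \<open>0 \<le> y * r\<close> xy by (simp add: divide_le_eq D_def)
  qed
  have frac: "x / (1 + x * (y / (1 + y * r))) = x * (1 + y * r) / D r" if "0 \<le> r" for r
  proof -
    have "1 + x * (y / (1 + y * r)) = D r / (1 + y * r)"
      using pos(1)[OF that] by (simp add: D_def field_simps)
    then show ?thesis by simp
  qed
  define P where "P = (x * y / D s) * (x * y / D t)"
  have diff: "x * (1 + y * s) / D s - x * (1 + y * t) / D t = P * (s - t)"
    using pos(2)[OF st(1)] pos(2)[OF st(2)] unfolding P_def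
    by (simp add: field_simps) (simp add: D_def algebra_simps)
  have "P \<le> 1 / 2 * (1 / 2)"
    unfolding P_def using half st pos(2) xy by (intro mult_mono) (auto intro: divide_nonneg_pos)
  then have "P * \<bar>s - t\<bar> \<le> 1 / 4 * \<bar>s - t\<bar>"
    by (intro mult_right_mono) auto
  moreover have "0 \<le> P"
    unfolding P_def using pos(2) st x y by (intro mult_nonneg_nonneg divide_nonneg_pos) auto
  ultimately show ?thesis
    unfolding frac[OF st(1)] frac[OF st(2)] diff by (simp add: abs_mult)
qed

lemma cf_trunc_Cauchy:
  assumes "x \<in> unit_seqs"
  shows "\<bar>cf_trunc n x - cf_trunc (n + k) x\<bar> \<le> 2 * (1/2) ^ n"
  using assms
proof (induction n arbitrary: x rule: induct_nat_012)
  case 0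
  then show ?case using cf_trunc_bounds[of x k] by simp
next
  case 1
  then show ?case using cf_trunc_bounds[of x "Suc 0"] cf_trunc_bounds[of x "Suc k"] 
    by (auto simp del: cf_trunc.simps simp: abs_le_iff)
next
  case (ge2 n)
  define y where "y = (\<lambda>i. x (Suc (Suc i)))"
  have y: "y \<in> unit_seqs" using ge2.prems by (simp add: y_def unit_seqs_def)
  have "\<bar>cf_trunc (Suc (Suc n)) x - cf_trunc (Suc (Suc n) + k) x\<bar>
      \<le> \<bar>cf_trunc n y - cf_trunc (n + k) y\<bar> / 4"
    using two_step_contraction[of "x 0" "x (Suc 0)" "cf_trunc n y" "cf_trunc (n + k) y"]
      ge2.prems cf_trunc_bounds[OF y] by (simp add: y_def unit_seqs_def)
  also have "\<dots> \<le> 2 * (1/2) ^ n / 4" using ge2.IH(1)[OF y] by simp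
  also have "\<dots> = 2 * (1/2) ^ Suc (Suc n)" by simp
  finally show ?case .
qed

lemma eventually_two_halves_power_less:
  fixes e :: real
  assumes "0 < e"
  shows "\<forall>\<^sub>F n in sequentially. 2 * (1/2) ^ n < e"
proof -
  have "(\<lambda>n. 2 * (1/2::real) ^ n) \<longlonglongrightarrow> 2 * 0"
    by (intro tendsto_mult_left LIMSEQ_power_zero) simp
  then show ?thesis
    by (rule order_tendstoD(2)) (simp add: assms)
qed

lemma cf_trunc_tendsto:
  assumes "x \<in> unit_seqs"
  shows "(\<lambda>n. cf_trunc n x) \<longlonglongrightarrow> cf_inv x"
proof -
  have "Cauchy (\<lambda>n. cf_trunc n x)"
  proof (rule CauchyI')
    fix e :: real assume "0 < e"
    obtain M where M: "\<And>n. M \<le> n \<Longrightarrow> 2 * (1/2::real) ^ n < e"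
      using eventually_two_halves_power_less[OF \<open>0 < e\<close>] unfolding eventually_sequentially by blast
    have "dist (cf_trunc m x) (cf_trunc n x) < e" if "M \<le> m" "m < n" for m n
      using cf_trunc_Cauchy[OF assms, of m "n - m"] M[OF that(1)] that(2) by (simp add: dist_real_def)
    then show "\<exists>M. \<forall>m\<ge>M. \<forall>n>m. dist (cf_trunc m x) (cf_trunc n x) < e" by blast
  qed
  then show ?thesis
    unfolding cf_inv_def by (simp add: Cauchy_convergent flip: convergent_LIMSEQ_iff)
qed

lemma cf_inv_bounds: "x \<in> unit_seqs \<Longrightarrow> cf_inv x \<in> {0..1}"
  by (rule closed_sequentially[OF closed_atLeastAtMost cf_trunc_bounds cf_trunc_tendsto])

lemma continuous_on_coordinate: "continuous_on S (\<lambda>x::'a \<Rightarrow> 'b::topological_space. x i)"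
  by (rule continuous_on_subset[OF continuous_on_product_coordinates]) simp

lemma continuous_on_cf_trunc: "continuous_on unit_seqs (cf_trunc n)"
proof (induction n)
  case (Suc n)
  have "continuous_on unit_seqs (\<lambda>x. cf_trunc n (\<lambda>i. x (Suc i)))"
    by (rule continuous_on_compose2[OF Suc])
       (auto intro!: continuous_on_coordinatewise_then_product continuous_on_coordinate unit_seqs_tail)
  moreover have "1 + x 0 * cf_trunc n (\<lambda>i. x (Suc i)) \<noteq> 0" if "x \<in> unit_seqs" for x
  proof -
    have "0 \<le> x 0 * cf_trunc n (\<lambda>i. x (Suc i))"
      using cf_trunc_bounds[OF unit_seqs_tail[OF that], of n] that by (auto simp: unit_seqs_def)
    then show ?thesis by linarith
  qed
  ultimately show ?case
    by (auto intro!: continuous_intros continuous_on_coordinate)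
qed simp

text \<open>A uniform limit of continuous functions.\<close>

lemma continuous_on_cf_inv: "continuous_on unit_seqs cf_inv"
proof (rule uniform_limit_theorem)
  show "uniform_limit unit_seqs cf_trunc cf_inv sequentially"
  proof (rule uniform_limitI)
    fix e :: real assume "0 < e"
    from eventually_two_halves_power_less[OF \<open>0 < e\<close>] show "\<forall>\<^sub>F n in sequentially. \<forall>x\<in>unit_seqs. dist (cf_trunc n x) (cf_inv x) < e"
    proof eventually_elim
      case (elim n)
      have "dist (cf_trunc n x) (cf_inv x) \<le> 2 * (1/2) ^ n" if x: "x \<in> unit_seqs" for x
      proof (rule LIMSEQ_le_const2)
        show "(\<lambda>k. dist (cf_trunc n x) (cf_trunc (k + n) x)) \<longlonglongrightarrow> dist (cf_trunc n x) (cf_inv x)"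
          by (intro tendsto_dist tendsto_const LIMSEQ_ignore_initial_segment cf_trunc_tendsto x)
        show "\<exists>N. \<forall>k\<ge>N. dist (cf_trunc n x) (cf_trunc (k + n) x) \<le> 2 * (1/2) ^ n"
          using cf_trunc_Cauchy[OF x, of n] by (simp add: dist_real_def add.commute)
      qed
      with elim show ?case by (meson le_less_trans)
    qed
  qed
qed (auto simp: continuous_on_cf_trunc)

text \<open>The codes of finite partial quotients. They accumulate only at \<open>0\<close>, the code of \<open>\<infinity>\<close>.\<close>

definition quotient_codes :: "real set" where
  "quotient_codes = range (\<lambda>n. inverse (real (Suc n)))"

definition decode :: "real \<Rightarrow> enat" where
  "decode r = (if r = 0 then \<infinity> else enat (nat \<lfloor>inverse r\<rfloor>))"

lemma decode_inverse: "1 \<le> n \<Longrightarrow> decode (inverse (real n)) = enat n"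
  by (simp add: decode_def)

lemma quotient_codesE:
  assumes "r \<in> quotient_codes"
  obtains n where "1 \<le> n" "r = inverse (real n)"
proof -
  from assms obtain m where "r = inverse (real (Suc m))"
    unfolding quotient_codes_def by blast
  then show thesis by (intro that[of "Suc m"]) simp_all
qed

lemma inverse_in_quotient_codes: "1 \<le> n \<Longrightarrow> inverse (real n) \<in> quotient_codes"
  unfolding quotient_codes_def by (intro image_eqI[of _ _ "n - 1"]) auto

lemma compact_codes: "compact (insert 0 quotient_codes)"
  unfolding quotient_codes_def
  by (rule compact_sequence_with_limit[OF LIMSEQ_inverse_real_of_nat])

lemma codes_unit: "r \<in> insert 0 quotient_codes \<Longrightarrow> r \<in> {0..1}"
  by (auto elim!: quotient_codesE simp: inverse_le_1_iff)

lemma decode_ge_1: "r \<in> insert 0 quotient_codes \<Longrightarrow> 1 \<le> decode r"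
  by (auto elim!: quotient_codesE simp: decode_inverse one_enat_def) (simp add: decode_def)

lemma decode_large:
  assumes "r \<in> insert 0 quotient_codes" "r < inverse (real (Suc C))"
  shows "enat C < decode r"
proof (cases "r = 0")
  case False
  with assms(1) have "r \<in> quotient_codes" by simp
  then obtain n where n: "1 \<le> n" "r = inverse (real n)" by (rule quotient_codesE)
  have "inverse (real n) < inverse (real (Suc C))" using assms(2) n(2) by simp
  then have "real (Suc C) < real n"
    by (rule inverse_less_imp_less) (use n(1) in simp)
  then have "C < n" by linarith
  with n show ?thesis by (simp add: decode_inverse)
qed (simp add: decode_def)

text \<open>Inverting turns the codes into natural numbers, with \<open>0\<close> for the code \<open>0\<close> because \<open>inverse 0 = 0\<close>. A
  convergent sequence of natural numbers is eventually constant.\<close>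

lemma codes_isolated:
  assumes y: "\<And>n. y n \<in> insert 0 quotient_codes" and lim: "y \<longlonglongrightarrow> w"
    and w: "w \<in> quotient_codes"
  shows "\<forall>\<^sub>F n in sequentially. y n = w"
proof -
  obtain a where a: "1 \<le> a" "w = inverse (real a)" using w by (rule quotient_codesE)
  have "(\<lambda>n. inverse (y n)) \<longlonglongrightarrow> inverse w"
    using lim a by (intro tendsto_inverse) auto
  then have "\<forall>\<^sub>F n in sequentially. dist (inverse (y n)) (inverse w) < 1"
    by (rule tendstoD) simp
  then show ?thesis
  proof eventually_elim
    case (elim n)
    have "\<exists>b::nat. inverse (y n) = real b"
    proof (cases "y n = 0")
      case False
      with y[of n] have "y n \<in> quotient_codes" by simp
      then obtain b where "y n = inverse (real b)" by (rule quotient_codesE)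
      then show ?thesis by simp
    qed (intro exI[of _ 0], simp)
    then obtain b :: nat where b: "inverse (y n) = real b" by blast
    with elim a have "\<bar>real b - real a\<bar> < 1" by (simp add: dist_real_def)
    then have "b = a" by linarith
    with a b have "inverse (y n) = inverse w" by simp
    then show "y n = w" by (rule inverse_eq_imp_eq)
  qed
qed

section \<open>Perron functions on a compact shift space\<close>

text \<open>The value of the Perron function at place \<open>0\<close>; the word of length \<open>l\<close> occupies the places \<open>0\<close> to
  \<open>l - 1\<close>.\<close>

definition coded_perron :: "nat \<Rightarrow> perron_fun \<Rightarrow> (int \<Rightarrow> real) \<Rightarrow> ereal" where
  "coded_perron l f x =
     f (cf_inv (\<lambda>i. x (int l + int i))) (cf_inv (\<lambda>i. x (- 1 - int i)))
       (map (\<lambda>i. decode (x (int i))) [0..<l])"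

lemma perron_val_coded:
  assumes "a \<in> pos_seqs"
  shows "perron_val l f a k = coded_perron l f (shift k (\<lambda>i. inverse (real (a i))))"
proof -
  have a: "1 \<le> a i" for i using assms by (simp add: pos_seqs_def)
  have "alpha_cf a (k + int l - 1) = cf_inv (\<lambda>i. inverse (real (a (k + (int l + int i)))))"
    unfolding alpha_cf_def by (subst cfrac_eq_cf_inv) (rule a, simp add: algebra_simps)
  moreover have "beta_cf a k = cf_inv (\<lambda>i. inverse (real (a (k + (- 1 - int i)))))"
    unfolding beta_cf_def by (subst cfrac_eq_cf_inv) (rule a, simp add: algebra_simps)
  ultimately show ?thesis
    unfolding perron_val_def coded_perron_def by (simp add: decode_inverse[OF a])
qed

lemma good_continuityE:
  assumes "good_continuity l f"
  obtains I where
    "\<forall>B. open B \<and> I \<in> B \<longrightarrow>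
       (\<exists>C::nat. \<forall>\<alpha>\<in>{0..1}. \<forall>\<beta>\<in>{0..1}. \<forall>ns\<in>perron_args l.
          (\<exists>n\<in>set ns. enat C < n) \<longrightarrow> f \<alpha> \<beta> ns \<in> B)"
    "\<forall>\<alpha>\<in>{0..1}. \<forall>\<beta>\<in>{0..1}. \<forall>ns\<in>perron_args l. \<infinity> \<in> set ns \<longrightarrow> f \<alpha> \<beta> ns = I"
    "\<forall>ns\<in>perron_args l. \<infinity> \<notin> set ns \<longrightarrow>
       continuous_on ({0..1} \<times> {0..1}) (\<lambda>(\<alpha>, \<beta>). f \<alpha> \<beta> ns)"
  using assms unfolding good_continuity_def by (elim conjE exE) (rule that)

text \<open>At a sequence with a letter \<open>0\<close> in its word, a nearby sequence has a large or infinite quotient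
  there, and the first condition of good continuity applies. Otherwise the word of a nearby sequence
  is the same, and only the two continued fractions vary.\<close>

lemma continuous_on_coded_perron:
  assumes "good_continuity l f"
  shows "continuous_on (full_shift (insert 0 quotient_codes)) (coded_perron l f)"
  unfolding continuous_on_sequentially
proof (intro allI ballI impI, elim conjE)
  let ?X = "full_shift (insert 0 quotient_codes)"
  fix y :: "nat \<Rightarrow> int \<Rightarrow> real" and w
  assume w: "w \<in> ?X" and y: "\<forall>n. y n \<in> ?X" and lim: "y \<longlonglongrightarrow> w"
  obtain I where
    near_inf: "\<forall>B. open B \<and> I \<in> B \<longrightarrow>
       (\<exists>C::nat. \<forall>\<alpha>\<in>{0..1}. \<forall>\<beta>\<in>{0..1}. \<forall>ns\<in>perron_args l.
          (\<exists>n\<in>set ns. enat C < n) \<longrightarrow> f \<alpha> \<beta> ns \<in> B)" and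
    at_inf: "\<forall>\<alpha>\<in>{0..1}. \<forall>\<beta>\<in>{0..1}. \<forall>ns\<in>perron_args l. \<infinity> \<in> set ns \<longrightarrow> f \<alpha> \<beta> ns = I" and
    cont: "\<forall>ns\<in>perron_args l. \<infinity> \<notin> set ns \<longrightarrow>
       continuous_on ({0..1} \<times> {0..1}) (\<lambda>(\<alpha>, \<beta>). f \<alpha> \<beta> ns)"
    using assms by (rule good_continuityE)
  define right where "right x = (\<lambda>i. x (int l + int i))" for x :: "int \<Rightarrow> real"
  define left where "left x = (\<lambda>i. x (- 1 - int i))" for x :: "int \<Rightarrow> real"
  define word where "word x = map (\<lambda>i. decode (x (int i))) [0..<l]" for x
  have F: "coded_perron l f x = f (cf_inv (right x)) (cf_inv (left x)) (word x)" for x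
    by (simp add: coded_perron_def right_def left_def word_def)
  have in_unit: "right x \<in> unit_seqs" "left x \<in> unit_seqs" if "x \<in> ?X" for x
    using that codes_unit unfolding right_def left_def unit_seqs_def full_shift_def by blast+
  then have cf01: "cf_inv (right x) \<in> {0..1}" "cf_inv (left x) \<in> {0..1}" if "x \<in> ?X" for x
    using that cf_inv_bounds by blast+
  have word: "word x \<in> perron_args l" if "x \<in> ?X" for x
    using that by (auto simp: word_def perron_args_def full_shift_def intro!: decode_ge_1)
  have coord: "(\<lambda>n. y n i) \<longlonglongrightarrow> w i" for i
    using lim by (simp add: tendsto_fun_iff)
  show "(coded_perron l f \<circ> y) \<longlonglongrightarrow> coded_perron l f w"
  proof (cases "\<exists>i<l. w (int i) = 0")
    case True
    then obtain i where i: "i < l" "w (int i) = 0" by blast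
    have "\<infinity> \<in> set (word w)"
      using i by (force simp: word_def decode_def image_iff)
    then have Fw: "coded_perron l f w = I"
      unfolding F by (intro at_inf[rule_format] cf01 word w)
    show ?thesis
    proof (rule topological_tendstoI)
      fix B assume "open B" "coded_perron l f w \<in> B"
      then have "open B \<and> I \<in> B" by (simp add: Fw)
      with near_inf obtain C :: nat where
        C: "\<forall>\<alpha>\<in>{0..1}. \<forall>\<beta>\<in>{0..1}. \<forall>ns\<in>perron_args l.
          (\<exists>n\<in>set ns. enat C < n) \<longrightarrow> f \<alpha> \<beta> ns \<in> B"
        by meson
      have "\<forall>\<^sub>F n in sequentially. y n (int i) < inverse (real (Suc C))"
        using order_tendstoD(2)[OF coord[of "int i"], of "inverse (real (Suc C))"] i by simp
      then show "\<forall>\<^sub>F n in sequentially. (coded_perron l f \<circ> y) n \<in> B"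
      proof eventually_elim
        case (elim n)
        have "enat C < decode (y n (int i))"
          using y elim by (intro decode_large) (auto simp: full_shift_def)
        then have "\<exists>n\<in>set (word (y n)). enat C < n"
          using i(1) by (auto simp: word_def)
        then show ?case
          unfolding o_def F by (intro C[rule_format] cf01 word) (use y in auto)
      qed
    qed
  next
    case False
    have code: "w (int i) \<in> quotient_codes" if "i < l" for i
      using False w that by (auto simp: full_shift_def)
    have "\<forall>\<^sub>F n in sequentially. \<forall>i\<in>{..<l}. y n (int i) = w (int i)"
      using y code by (intro eventually_ball_finite ballI codes_isolated coord) (auto simp: full_shift_def)
    then have same: "\<forall>\<^sub>F n in sequentially. f (cf_inv (right (y n))) (cf_inv (left (y n))) (word w) = (coded_perron l f \<circ> y) n"
      by (rule eventually_mono) (auto simp: F word_def intro!: arg_cong[where f = "f _ _"])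
    have "\<infinity> \<notin> set (word w)"
      using False by (auto simp: word_def decode_def)
    then have "continuous_on ({0..1} \<times> {0..1}) (\<lambda>(\<alpha>, \<beta>). f \<alpha> \<beta> (word w))"
      by (rule cont[rule_format, OF word[OF w]])
    moreover have "(\<lambda>n. (cf_inv (right (y n)), cf_inv (left (y n)))) \<longlonglongrightarrow> (cf_inv (right w), cf_inv (left w))"
      using w y coord in_unit
      by (intro tendsto_Pair continuous_on_tendsto_compose[OF continuous_on_cf_inv])
         (auto simp: tendsto_fun_iff right_def left_def)
    ultimately have "(\<lambda>n. (\<lambda>(\<alpha>, \<beta>). f \<alpha> \<beta> (word w)) (cf_inv (right (y n)), cf_inv (left (y n))))
        \<longlonglongrightarrow> (\<lambda>(\<alpha>, \<beta>). f \<alpha> \<beta> (word w)) (cf_inv (right w), cf_inv (left w))"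
      by (rule continuous_on_tendsto_compose) (use w y cf01 in auto)
    then show ?thesis
      using same by (auto simp: F intro: Lim_transform_eventually)
  qed
qed

lemma pos_seqs_coded:
  "full_shift quotient_codes = (\<lambda>a i. inverse (real (a i))) ` pos_seqs"
  "periodic_points quotient_codes = (\<lambda>a i. inverse (real (a i))) ` periodic_seqs"
proof -
  have code: "(\<lambda>i. inverse (real (a i))) \<in> full_shift quotient_codes" if "a \<in> pos_seqs" for a
    using that by (auto simp: full_shift_def pos_seqs_def intro!: inverse_in_quotient_codes)
  have ex: "\<exists>a\<in>pos_seqs. x = (\<lambda>i. inverse (real (a i)))" if "x \<in> full_shift quotient_codes" for x
  proof -
    have "\<forall>i. \<exists>n. 1 \<le> n \<and> x i = inverse (real n)"
    proof
      fix i
      have "x i \<in> quotient_codes" using that by (simp add: full_shift_def)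
      then show "\<exists>n. 1 \<le> n \<and> x i = inverse (real n)" by (rule quotient_codesE) blast
    qed
    then obtain a where "\<And>i. 1 \<le> a i \<and> x i = inverse (real (a i))" by metis
    then show ?thesis by (intro bexI[of _ a]) (auto simp: pos_seqs_def)
  qed
  show "full_shift quotient_codes = (\<lambda>a i. inverse (real (a i))) ` pos_seqs"
    using code ex by blast
  show "periodic_points quotient_codes = (\<lambda>a i. inverse (real (a i))) ` periodic_seqs"
  proof (intro antisym subsetI)
    fix x assume x: "x \<in> periodic_points quotient_codes"
    then obtain a where "a \<in> pos_seqs" "x = (\<lambda>i. inverse (real (a i)))"
      using ex by (auto simp: periodic_points_def)
    then show "x \<in> (\<lambda>a i. inverse (real (a i))) ` periodic_seqs"
      using x by (auto simp: periodic_points_def periodic_seqs_def)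
  next
    fix x assume "x \<in> (\<lambda>a i. inverse (real (a i))) ` periodic_seqs"
    then show "x \<in> periodic_points quotient_codes"
      using code by (auto simp: periodic_points_def periodic_seqs_def)
  qed
qed

lemma sigma_limsup_eq_closure:
  assumes "good_continuity l f"
  shows "sigma_limsup l f = closure (tau_limsup l f)"
proof -
  let ?\<Lambda> = "\<lambda>x. Limsup abs_at_top (\<lambda>k. coded_perron l f (shift k x))"
  let ?code = "\<lambda>a i. inverse (real (a i))"
  have val: "Limsup abs_at_top (perron_val l f a) = ?\<Lambda> (?code a)" if "a \<in> pos_seqs" for a
    by (rule arg_cong[where f = "Limsup abs_at_top"]) (simp add: fun_eq_iff perron_val_coded[OF that])
  have "sigma_limsup l f = {?\<Lambda> x | x. x \<in> full_shift quotient_codes}"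
    unfolding sigma_limsup_def Setcompr_eq_image pos_seqs_coded image_image
    by (rule image_cong[OF refl val])
  also have "\<dots> = closure {?\<Lambda> x | x. x \<in> periodic_points quotient_codes}"
    by (rule Limsup_spectrum_eq_closure[OF compact_codes _ continuous_on_coded_perron[OF assms]]) auto
  also have "{?\<Lambda> x | x. x \<in> periodic_points quotient_codes} = tau_limsup l f"
    unfolding tau_limsup_def Setcompr_eq_image pos_seqs_coded image_image
    by (rule image_cong[OF refl val [symmetric]]) (simp add: periodic_seqs_def)
  finally show ?thesis .
qed

lemma good_continuity_uminus:
  assumes "good_continuity l f"
  shows "good_continuity l (\<lambda>\<alpha> \<beta> ns. - f \<alpha> \<beta> ns)"
proof -
  obtain I where
    near_inf: "\<forall>B. open B \<and> I \<in> B \<longrightarrow>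
       (\<exists>C::nat. \<forall>\<alpha>\<in>{0..1}. \<forall>\<beta>\<in>{0..1}. \<forall>ns\<in>perron_args l.
          (\<exists>n\<in>set ns. enat C < n) \<longrightarrow> f \<alpha> \<beta> ns \<in> B)" and
    at_inf: "\<forall>\<alpha>\<in>{0..1}. \<forall>\<beta>\<in>{0..1}. \<forall>ns\<in>perron_args l. \<infinity> \<in> set ns \<longrightarrow> f \<alpha> \<beta> ns = I" and
    cont: "\<forall>ns\<in>perron_args l. \<infinity> \<notin> set ns \<longrightarrow>
       continuous_on ({0..1} \<times> {0..1}) (\<lambda>(\<alpha>, \<beta>). f \<alpha> \<beta> ns)"
    using assms by (rule good_continuityE)
  have "\<exists>C::nat. \<forall>\<alpha>\<in>{0..1}. \<forall>\<beta>\<in>{0..1}. \<forall>ns\<in>perron_args l.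
      (\<exists>n\<in>set ns. enat C < n) \<longrightarrow> - f \<alpha> \<beta> ns \<in> B" if "open B" "- I \<in> B" for B
  proof -
    have "open (uminus ` B)" using that(1) by (rule ereal_open_uminus)
    moreover have "I \<in> uminus ` B" using that(2) by (metis image_eqI ereal_uminus_uminus)
    moreover have "z \<in> uminus ` B \<longleftrightarrow> - z \<in> B" for z by (metis image_iff ereal_uminus_uminus)
    ultimately show ?thesis using near_inf[rule_format, of "uminus ` B"] by simp
  qed
  moreover have "continuous_on ({0..1} \<times> {0..1}) (\<lambda>(\<alpha>, \<beta>). - f \<alpha> \<beta> ns)"
    if "ns \<in> perron_args l" "\<infinity> \<notin> set ns" for ns
    using continuous_on_compose[OF cont[rule_format, OF that] continuous_uminus_ereal]
    by (simp add: o_def case_prod_unfold)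
  ultimately show ?thesis
    unfolding good_continuity_def using at_inf by (intro conjI exI[of _ "- I"]) simp_all
qed

lemma closure_uminus_ereal: "closure (uminus ` S) = uminus ` closure (S :: ereal set)"
proof -
  have sub: "uminus ` closure T \<subseteq> closure (uminus ` T)" for T :: "ereal set"
    by (intro image_closure_subset continuous_uminus_ereal closed_closure closure_subset)
  have "closure (uminus ` S) = uminus ` uminus ` closure (uminus ` S)"
    by (simp add: image_image)
  also have "\<dots> \<subseteq> uminus ` closure (uminus ` uminus ` S)"
    by (intro image_mono sub)
  also have "\<dots> = uminus ` closure S" by (simp add: image_image)
  finally show ?thesis using sub[of S] by blast
qed

lemma Liminf_perron_val:
  "Liminf F (perron_val l f a) = - Limsup F (perron_val l (\<lambda>\<alpha> \<beta> ns. - f \<alpha> \<beta> ns) a)"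
  unfolding ereal_Limsup_uminus [symmetric] perron_val_def
  by (simp flip: ereal_Liminf_uminus)

lemma liminf_spectra_uminus:
  "sigma_liminf l f = uminus ` sigma_limsup l (\<lambda>\<alpha> \<beta> ns. - f \<alpha> \<beta> ns)"
  "tau_liminf l f = uminus ` tau_limsup l (\<lambda>\<alpha> \<beta> ns. - f \<alpha> \<beta> ns)"
  unfolding sigma_liminf_def sigma_limsup_def tau_liminf_def tau_limsup_def Liminf_perron_val
    Setcompr_eq_image image_image
  by (rule refl)+

theorem theorem46:
  fixes l :: nat and f :: perron_fun
  assumes "good_continuity l f"
  shows "sigma_liminf l f = closure (tau_liminf l f) \<and>
         sigma_limsup l f = closure (tau_limsup l f)"
  using sigma_limsup_eq_closure[OF assms]
    sigma_limsup_eq_closure[OF good_continuity_uminus[OF assms]]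
  by (simp add: liminf_spectra_uminus closure_uminus_ereal)

end
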